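(* Let $m\ge 1$ be an integer, $q=3^m$, and let $\theta\in\mathbb{F}_{q^2}$ be such that $\theta^{q+1}$ is a nonsquare in $\mathbb{F}_q$. Let $\mathcal{U}_\theta=\{(x,t\theta):x\in\mathbb{F}_{q^2},\,t\in\mathbb{F}_q\}\cup\{(\infty)\}$, which is a unital in the plane $\Pi(x^2)$ over $\mathbb{F}_{q^2}$. Then \[\dim C_2(\mathcal{U}_\theta)\ \ge\ \begin{cases}\frac{2}{3}(q^3+q^2-2q)-1, & m \text{ even},\\[3pt] \frac{2}{3}(q^3+q^2+q)-1, & m\text{ odd}.\end{cases}\]
   Context: The plane $\Pi(x^2)$: let $f(x)=x^2$ on $\mathbb{F}=\mathbb{F}_{q^2}$. The projective plane $\Pi(f)$ has points $(x,y)\in\mathbb{F}\times\mathbb{F}$ and $(a)$ for $a\in\mathbb{F}\cup\{\infty\}$; its lines are $L_{a,b}=\{(x,f(x+a)-b):x\in\mathbb{F}\}\cup\{(a)\}$ for $(a,b)\in\mathbb{F}\times\mathbb{F}$, $N_a=\{(a,y):y\in\mathbb{F}\}\cup\{(\infty)\}$ for $a\in\mathbb{F}$, and $L_\infty=\{(a):a\in\mathbb{F}\cup\{\infty\}\}$. A unital in a projective plane of order $q^2$ is a set $\mathcal{U}$ of $q^3+1$ points such that each line meets $\mathcal{U}$ in $1$ or $q+1$ points. It is known that when $\theta^{q+1}$ is a nonsquare in $\mathbb{F}_q$, $\mathcal{U}_\theta$ is a unital in $\Pi(x^2)$. As a design, its points are the elements of $\mathcal{U}_\theta$ and its blocks are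 the intersections of $\mathcal{U}_\theta$ with lines of $\Pi(x^2)$ that have $q+1$ points; it is a $2$-$(q^3+1,q+1,1)$ design. $C_2(\mathcal{U}_\theta)$ is the subspace of $\mathbb{F}_2^{q^3+1}$ (coordinates indexed by the points of $\mathcal{U}_\theta$) spanned by the characteristic vectors of the blocks of $\mathcal{U}_\theta$. *)

theory Defs
  imports "HOL-Analysis.Analysis" "HOL-Library.Z2"
begin

text \<open>
  The field of order \<open>q\<^sup>2\<close> is a finite field type \<open>'a\<close> with \<open>CARD('a) = q\<^sup>2\<close>.
  A point of the plane is an affine point \<open>(x, y)\<close> or a point \<open>(a)\<close> at infinity,
  where \<open>a\<close> ranges over \<open>'a option\<close> and \<open>None\<close> stands for the symbol \<open>\<infinity>\<close>.
\<close>

datatype 'a point = Affine 'a 'a | At_Infinity "'a option"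

instance point :: (finite) finite
proof
  have "p \<in> range (\<lambda>(x, y). Affine x y) \<union> range At_Infinity" for p :: "'a point"
    by (cases p) auto
  then have "(UNIV :: 'a point set) = range (\<lambda>(x, y). Affine x y) \<union> range At_Infinity"
    by blast
  moreover have "finite (range (\<lambda>(x, y). Affine x y :: 'a point) \<union> range At_Infinity)"
    by simp
  ultimately show "finite (UNIV :: 'a point set)"
    by simp
qed

definition line_L :: "('a :: field \<Rightarrow> 'a) \<Rightarrow> 'a \<Rightarrow> 'a \<Rightarrow> 'a point set" where
  "line_L f a b = {Affine x (f (x + a) - b) |x. True} \<union> {At_Infinity (Some a)}"

definition line_N :: "'a :: field \<Rightarrow> 'a point set" where
  "line_N a = {Affine a y |y. True} \<union> {At_Infinity None}"

definition line_at_infinity :: "'a :: field point set" where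
  "line_at_infinity = {At_Infinity a |a. True}"

definition plane_lines :: "('a :: field \<Rightarrow> 'a) \<Rightarrow> 'a point set set" where
  "plane_lines f =
     {line_L f a b |a b. True} \<union> {line_N a |a. True} \<union> {line_at_infinity}"

text \<open>
  When \<open>CARD('a) = q\<^sup>2\<close>, the subfield of order \<open>q\<close> of \<open>'a\<close> is unique and
  is the fixed field of the automorphism \<open>x \<mapsto> x\<^sup>q\<close>.
\<close>

definition subfield_of_order :: "nat \<Rightarrow> 'a :: field set" where
  "subfield_of_order q = {t. t ^ q = t}"

definition nonsquare_in :: "'a :: field set \<Rightarrow> 'a \<Rightarrow> bool" where
  "nonsquare_in K c \<longleftrightarrow> c \<in> K \<and> \<not> (\<exists>s\<in>K. c = s ^ 2)"

definition unital_U :: "nat \<Rightarrow> 'a :: field \<Rightarrow> 'a point set" where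
  "unital_U q \<theta> =
     {Affine x (t * \<theta>) |x t. t \<in> subfield_of_order q} \<union> {At_Infinity None}"

definition blocks :: "nat \<Rightarrow> ('a :: field \<Rightarrow> 'a) \<Rightarrow> 'a point set \<Rightarrow> 'a point set set" where
  "blocks q f U = {U \<inter> L |L. L \<in> plane_lines f \<and> card (U \<inter> L) = q + 1}"

definition char_vec :: "'p set \<Rightarrow> bit ^ 'p" where
  "char_vec B = (\<chi> p. if p \<in> B then 1 else 0)"

text \<open>
  Coordinates are indexed by all points of the plane instead of only those of \<open>U\<close>.
  All blocks are subsets of \<open>U\<close>, so every code word vanishes outside \<open>U\<close>, and
  restricting coordinates to \<open>U\<close> is a linear isomorphism onto the code
  with coordinates indexed by \<open>U\<close>.
\<close>

definition binary_code ::
    "nat \<Rightarrow> ('a :: {field, finite} \<Rightarrow> 'a) \<Rightarrow> 'a point set \<Rightarrow> (bit ^ 'a point) set" where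
  "binary_code q f U = vec.span (char_vec ` blocks q f U)"

end

theory Submission
  imports Defs "HOL-Computational_Algebra.Polynomial" "HOL-Computational_Algebra.Primes"
begin

text \<open>
  Let \<open>F\<close> and \<open>K\<close> be the fields of order \<open>q\<^sup>2\<close> and \<open>q\<close>. The affine points of the unital form the
  group \<open>F \<times> M\<close> with \<open>M = K\<theta>\<close>, of odd order \<open>q\<^sup>3 = 3\<^bsup>3m\<^esup>\<close>, whose translations preserve the
  unital. Over the field with four elements the code therefore splits into characters
  \<open>\<chi>(\<kappa>x + \<gamma>y)\<close> of this group, and its dimension is at least the number of characters that occur.
  The vertical lines give \<open>\<gamma> = 0\<close>. For \<open>\<gamma> \<noteq> 0\<close> the sum of all lines \<open>L\<^bsub>a,b\<^esub>\<close>, weighted by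
  \<open>\<chi>(-\<kappa>a - \<gamma>b)\<close>, is the character times \<open>\<chi>(\<kappa>\<^sup>2/\<gamma>)\<close>, because a quadratic Gauss sum is odd.
  The tangents, which are not blocks, contribute the character itself to this sum, so the character
  occurs as soon as \<open>Tr(\<kappa>\<^sup>2/\<gamma>) \<noteq> 0\<close>. Since \<open>\<gamma>\<close> only matters modulo the annihilator \<open>P\<close> of \<open>M\<close>,
  for \<open>\<gamma> \<notin> P\<close> the character can be missing only if \<open>Tr(\<kappa>\<^sup>2/\<gamma>)\<close> and \<open>Tr(\<kappa>\<^sup>2/(\<gamma> + l))\<close> both vanish
  for a fixed nonzero \<open>l \<in> P\<close>; these are two independent linear conditions on \<open>\<kappa>\<^sup>2\<close>, leaving at
  most \<open>2q\<^sup>2/9 - 1\<close> values of \<open>\<kappa>\<close>.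
\<close>

subsection \<open>The field with four elements\<close>

text \<open>\<open>GF4 a b\<close> stands for \<open>a + b\<omega>\<close> with \<open>\<omega>\<^sup>2 = \<omega> + 1\<close>; inversion is squaring.\<close>

datatype gf4 = GF4 bit bit

instantiation gf4 :: field
begin

definition "0 = GF4 0 0"
definition "1 = GF4 1 0"
fun plus_gf4 where "plus_gf4 (GF4 a b) (GF4 c d) = GF4 (a + c) (b + d)"
definition minus_gf4 :: "gf4 \<Rightarrow> gf4 \<Rightarrow> gf4" where "minus_gf4 x y = x + y"
definition uminus_gf4 :: "gf4 \<Rightarrow> gf4" where "uminus_gf4 x = x"
fun times_gf4 where
  "times_gf4 (GF4 a b) (GF4 c d) = GF4 (a * c + b * d) (a * d + b * c + b * d)"
definition inverse_gf4 :: "gf4 \<Rightarrow> gf4" where "inverse_gf4 x = x * x"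
definition divide_gf4 :: "gf4 \<Rightarrow> gf4 \<Rightarrow> gf4" where "divide_gf4 x y = x * (y * y)"

instance
proof
  fix a b c :: gf4
  obtain a1 a2 b1 b2 c1 c2 where abc: "a = GF4 a1 a2" "b = GF4 b1 b2" "c = GF4 c1 c2"
    by (metis gf4.exhaust)
  note [simp] = abc zero_gf4_def one_gf4_def minus_gf4_def uminus_gf4_def inverse_gf4_def
    divide_gf4_def
  show "0 + a = a" "- a + a = 0" "a - b = a + - b" "a div b = a * inverse b"
    "inverse (0::gf4) = 0" "(0::gf4) \<noteq> 1" "1 * a = a"
    by simp_all
  show "a + b = b + a" "a * b = b * a"
    by (cases a1; cases a2; cases b1; cases b2; simp)+
  show "a + b + c = a + (b + c)" "a * b * c = a * (b * c)" "(a + b) * c = a * c + b * c"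
    by (cases a1; cases a2; cases b1; cases b2; cases c1; cases c2; simp)+
  show "a \<noteq> 0 \<Longrightarrow> inverse a * a = 1"
    by (cases a1; cases a2) simp_all
qed

end

lemma gf4_add_self: "x + x = (0::gf4)"
  using add.left_inverse[of x] by (simp add: uminus_gf4_def)

lemma of_nat_gf4: "of_nat n = (if even n then 0 else 1 :: gf4)"
  by (induction n) (auto simp: gf4_add_self)

text \<open>For nonzero u, the distinct elements u and -u together contribute
  \<open>h u + h u\<close>, which is 0 in characteristic 2, so only the term at 0 survives.\<close>

lemma sum_even_function_gf4:
  fixes h :: "'a :: {field, finite} \<Rightarrow> gf4"
  assumes two: "(2::'a) \<noteq> 0" and even: "\<And>u. h (- u) = h u"
  shows "(\<Sum>u\<in>UNIV. h u) = h 0"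
proof -
  let ?A = "UNIV - {0::'a}" and ?p = "\<lambda>u::'a. {u, - u}"
  have "(\<Sum>u\<in>?A. h u) = (\<Sum>P\<in>?p ` ?A. \<Sum>u\<in>{u \<in> ?A. ?p u = P}. h u)"
    by (intro sum.image_gen) auto
  also have "\<dots> = 0"
  proof (rule sum.neutral, rule ballI)
    fix P assume "P \<in> ?p ` ?A"
    then obtain v where v: "v \<noteq> 0" "P = ?p v" by auto
    have "v \<noteq> - v"
    proof
      assume "v = - v"
      then have "2 * v = 0" by (metis add.right_inverse mult_2)
      then show False using two v by simp
    qed
    moreover have "{u \<in> ?A. ?p u = ?p v} = {v, - v}"
      using v by (auto simp: doubleton_eq_iff)
    ultimately show "(\<Sum>u\<in>{u \<in> ?A. ?p u = P}. h u) = 0"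
      using even unfolding v by (simp add: gf4_add_self)
  qed
  finally show ?thesis
    by (simp add: sum.remove[of UNIV 0])
qed

text \<open>An additive map is linear over the field with two elements, so the image of a basis of
  \<open>S\<close> spans the image of \<open>S\<close> over \<open>'k\<close>. Extending scalars
  thus cannot raise the dimension, and lower bounds over \<open>gf4\<close> pass to the binary
  code.\<close>

lemma card_independent_le_dim_bit:
  fixes f :: "bit ^ 'm \<Rightarrow> 'k :: field ^ 'n"
  assumes add: "\<And>v w. f (v + w) = f v + f w"
    and X: "vec.independent X" "X \<subseteq> vec.span (f ` S)"
  shows "card X \<le> vec.dim S"
proof -
  obtain B where B: "B \<subseteq> S" "vec.independent B" "S \<subseteq> vec.span B" "card B = vec.dim S"
    using vec.basis_exists[of S] by metis
  have finB: "finite B" using B(2) by (rule vec.finiteI_independent)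
  have f0: "f 0 = 0" using add[of 0 0] by simp
  have "f v \<in> vec.span (f ` B)" if "v \<in> vec.span B" for v
    using that
  proof (induction rule: vec.span_induct_alt)
    case base
    show ?case by (simp add: f0 vec.span_zero)
  next
    case (step c x y)
    have "c = 0 \<or> c = 1" by (cases c) auto
    moreover have "f x \<in> vec.span (f ` B)"
      using step.hyps by (intro vec.span_base imageI)
    ultimately show ?case using step by (auto simp: add f0 vec.span_add)
  qed
  then have "f ` S \<subseteq> vec.span (f ` B)" using B(3) by auto
  then have "X \<subseteq> vec.span (f ` B)"
    using X(2) vec.span_minimal[OF _ vec.subspace_span] by blast
  then have "card X \<le> card (f ` B)"
    using vec.independent_span_bound[OF _ X(1)] finB by blast
  also have "\<dots> \<le> card B" using finB by (rule card_image_le)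
  finally show ?thesis by (simp add: B)
qed

subsection \<open>Finite fields\<close>

lemma finite_field_fermat:
  fixes x :: "'a :: {field, finite}"
  shows "x ^ CARD('a) = x"
proof (cases "x = 0")
  case False
  let ?A = "UNIV - {0::'a}"
  have "(\<Prod>y\<in>?A. y) = (\<Prod>y\<in>?A. x * y)"
    using False by (intro prod.reindex_bij_witness[of _ "\<lambda>y. x * y" "\<lambda>y. y / x"]) auto
  also have "\<dots> = x ^ card ?A * (\<Prod>y\<in>?A. y)"
    by (simp add: prod.distrib)
  finally have "x ^ card ?A = 1" by simp
  moreover have "CARD('a) = Suc (card ?A)"
    by (intro card.remove) auto
  ultimately show ?thesis by (simp only: power_Suc mult_1_right)
qed auto

lemma of_nat_CARD_eq_0: "of_nat CARD('a) = (0::'a::{field,finite})"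
proof -
  have "(\<Sum>x\<in>UNIV. x) = (\<Sum>x\<in>UNIV. x + (1::'a))"
    by (intro sum.reindex_bij_witness[of _ "\<lambda>x. x + 1" "\<lambda>x. x - 1"]) auto
  then show ?thesis by (simp add: sum.distrib)
qed

lemma card_le_fibres:
  assumes "finite A" and "\<And>y. y \<in> f ` A \<Longrightarrow> card {x \<in> A. f x = y} \<le> k"
  shows "card A \<le> k * card (f ` A)"
proof -
  have "card A = (\<Sum>y\<in>f ` A. card {x \<in> A. f x = y})"
    unfolding card_eq_sum using assms(1) by (rule sum.image_gen)
  also have "\<dots> \<le> (\<Sum>y\<in>f ` A. k)" using assms(2) by (rule sum_mono)
  finally show ?thesis by (simp add: mult.commute)
qed

lemma card_le_twice_card_squares:
  fixes A :: "'a :: idom set"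
  assumes "finite A"
  shows "card A \<le> 2 * card (power2 ` A)"
proof (rule card_le_fibres[OF assms])
  fix y assume "y \<in> power2 ` A"
  then obtain i where "y = i\<^sup>2" by auto
  then have "{x \<in> A. x\<^sup>2 = y} \<subseteq> {i, - i}" by (auto simp: power2_eq_iff)
  then have "card {x \<in> A. x\<^sup>2 = y} \<le> card {i, - i}" by (intro card_mono) auto
  also have "\<dots> \<le> 2" by (simp add: card_insert_if)
  finally show "card {x \<in> A. x\<^sup>2 = y} \<le> 2" .
qed

text \<open>Euler's criterion by counting: X^n - 1 has at most n roots, all nonzero squares are
  among them, and there are at least n of these because squaring is at most two-to-one.\<close>

lemma square_criterion:
  fixes r :: "'a :: {field, finite}"
  assumes two: "(2::'a) \<noteq> 0" and odd: "odd CARD('a)" and r: "r ^ ((CARD('a) - 1) div 2) = 1"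
  shows "\<exists>j. r = j\<^sup>2"
proof -
  define n where "n = (CARD('a) - 1) div 2"
  have c2: "CARD('a) \<ge> 2" 
    using card_mono[of UNIV "{0,1::'a}"] by simp
  have n: "CARD('a) - 1 = 2 * n" "n > 0"
    using odd c2 unfolding n_def by presburger+
  define S where "S = (\<lambda>j::'a. j\<^sup>2) ` (UNIV - {0})"
  define R where "R = {x::'a. x ^ n = 1}"
  have "poly (monom 1 n - 1) 0 = (-1::'a)"
    using n(2) by (simp add: poly_monom)
  then have nz: "monom 1 n - 1 \<noteq> (0::'a poly)"
    by auto
  have deg: "degree (monom 1 n - 1 :: 'a poly) \<le> n"
    by (intro degree_diff_le) (auto simp: degree_monom_le)
  have "R = {x. poly (monom 1 n - 1) x = 0}"
    by (simp add: R_def poly_monom)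
  then have Rn: "card R \<le> n"
    using card_poly_roots_bound[OF nz] deg by simp
  have SR: "S \<subseteq> R"
  proof
    fix x assume "x \<in> S"
    then obtain j where j: "j \<noteq> 0" "x = j\<^sup>2" by (auto simp: S_def)
    have "j * j ^ (CARD('a) - 1) = j"
      using finite_field_fermat[of j] c2
      by (metis Suc_diff_1 One_nat_def Suc_1 less_le_trans power_Suc zero_less_Suc)
    then have "j ^ (2 * n) = 1" using j n by simp
    then show "x \<in> R" by (simp add: R_def j power_mult)
  qed
  have "card (UNIV - {0::'a}) \<le> 2 * card S"
    unfolding S_def by (rule card_le_twice_card_squares) simp
  then have "n \<le> card S" using n by (simp add: card_Diff_singleton)
  then have "S = R" using SR Rn by (intro card_seteq) auto
  with r show ?thesis by (auto simp: S_def R_def n_def)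
qed

section \<open>The subfield of order q in characteristic 3\<close>

locale conic_unital =
  fixes m q :: nat and \<theta> :: "'a :: {field, finite}"
  assumes m1: "m \<ge> 1" and q_def: "q = 3 ^ m" and card_a: "CARD('a) = q ^ 2"
    and nonsquare: "nonsquare_in (subfield_of_order q) (\<theta> ^ (q + 1))"
begin

lemma card_3: "CARD('a) = 3 ^ (2 * m)"
  by (simp add: card_a q_def power_even_eq)

lemma q_ge: "q \<ge> 3"
  using m1 by (cases m) (auto simp: q_def)

lemma three_eq_0: "(3::'a) = 0"
  using of_nat_CARD_eq_0[where 'a = 'a] by (simp add: card_3)

lemma char3: "CHAR('a) = 3"
proof -
  have "CHAR('a) dvd 3" using three_eq_0 by (simp flip: of_nat_eq_0_iff_char_dvd)
  moreover have "prime (3::nat)" by simp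
  ultimately show ?thesis using CHAR_not_1'[where 'a = 'a] by (metis One_nat_def prime_nat_iff)
qed

lemma two_eq: "(2::'a) = - 1"
  using three_eq_0 by (simp add: eq_neg_iff_add_eq_0)

lemma two_neq_0: "(2::'a) \<noteq> 0"
  by (simp add: two_eq)

lemma neg_eq_iff: "- x = x \<longleftrightarrow> x = (0::'a)"
proof
  assume "- x = x"
  then have "2 * x = 0" by (metis add.right_inverse mult_2)
  then show "x = 0" using two_neq_0 by simp
qed simp

lemma frob_add: "(x + y :: 'a) ^ 3 ^ i = x ^ 3 ^ i + y ^ 3 ^ i"
  using freshmans_dream'[where 'a = 'a, of "3 ^ i" i] by (simp add: char3)

lemma frob_q_add: "(x + y :: 'a) ^ q = x ^ q + y ^ q"
  by (simp add: q_def frob_add)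

lemma odd_q: "odd q" by (simp add: q_def)

lemma frob_q_minus: "(- x :: 'a) ^ q = - (x ^ q)"
  using odd_q by (rule power_minus_odd)

lemma frob_q_diff: "(x - y :: 'a) ^ q = x ^ q - y ^ q"
  using frob_q_add[of x "- y"] by (simp add: frob_q_minus)

lemma frob_q_frob_q: "((x::'a) ^ q) ^ q = x"
  using finite_field_fermat[of x] by (simp add: card_a power2_eq_square power_mult)

abbreviation "K \<equiv> subfield_of_order q :: 'a set"

lemma K_iff: "t \<in> K \<longleftrightarrow> t ^ q = t"
  by (simp add: subfield_of_order_def)

lemma K_add: "s \<in> K \<Longrightarrow> t \<in> K \<Longrightarrow> s + t \<in> K"
  and K_minus: "t \<in> K \<Longrightarrow> - t \<in> K"
  and K_mult: "s \<in> K \<Longrightarrow> t \<in> K \<Longrightarrow> s * t \<in> K"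
  and K_div: "s \<in> K \<Longrightarrow> t \<in> K \<Longrightarrow> s / t \<in> K"
  and K_0: "0 \<in> K"
  and K_1: "1 \<in> K"
  using q_ge by (auto simp: K_iff frob_q_add frob_q_minus power_mult_distrib power_divide)

lemma K_norm: "(x::'a) ^ (q + 1) \<in> K"
  by (simp add: K_iff power_add power_mult_distrib frob_q_frob_q mult.commute)

lemma card_roots_frob: "card {x::'a. x ^ q = c * x} \<le> q"
proof -
  let ?p = "monom 1 q - monom c 1 :: 'a poly"
  have q1: "q > 1" using q_ge by simp
  have "coeff ?p q = 1" using q1 by simp
  then have "?p \<noteq> 0" by (metis coeff_0 zero_neq_one)
  moreover have "degree ?p \<le> q"
    using q1 by (intro degree_diff_le) (auto intro: order_trans[OF degree_monom_le])
  ultimately have "card {x. poly ?p x = 0} \<le> q"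
    using card_poly_roots_bound order_trans by blast
  then show ?thesis by (simp add: poly_monom)
qed

text \<open>The additive map \<open>D\<close> has kernel \<open>K\<close>, and its values satisfy
  x^q = -x. Kernel and image have at most q elements each, while the product of their sizes is at
  least q^2.\<close>

lemma card_K: "card K = q"
proof -
  have le: "card K \<le> q" using card_roots_frob[of 1] by (simp add: subfield_of_order_def)
  define D where "D = (\<lambda>x::'a. x ^ q - x)"
  have "D ` UNIV \<subseteq> {x. x ^ q = (-1) * x}"
    by (auto simp: D_def frob_q_diff frob_q_frob_q)
  then have im: "card (D ` UNIV) \<le> q"
    using card_roots_frob[of "-1"] card_mono[of "{x::'a. x ^ q = (-1) * x}" "D ` UNIV"] by simp
  have "CARD('a) \<le> card K * card (D ` UNIV)"
  proof (rule card_le_fibres)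
    fix y assume "y \<in> D ` UNIV"
    then obtain x0 where x0: "y = D x0" by auto
    have "(\<lambda>x. x - x0) ` {x. D x = y} \<subseteq> K"
      by (auto simp: x0 D_def K_iff frob_q_diff algebra_simps)
    then show "card {x \<in> UNIV. D x = y} \<le> card K"
      by (intro card_inj_on_le[of "\<lambda>x. x - x0"]) (auto simp: inj_on_def)
  qed simp
  then have "q * q \<le> card (D ` UNIV) * card K"
    by (simp add: card_a power2_eq_square mult.commute)
  also have "\<dots> \<le> q * card K" using im by simp
  finally show ?thesis using le q_ge by simp
qed

text \<open>The exponent (q^2 - 1)/2 in Euler's criterion is a multiple of q - 1, and nonzero
  elements of \<open>K\<close> have (q - 1)-th power 1.\<close>

lemma K_square:
  assumes "r \<in> K" shows "\<exists>j::'a. r = j\<^sup>2"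
proof (cases "r = 0")
  case False
  have "r * r ^ (q - 1) = r"
    using assms q_ge by (metis K_iff Suc_diff_1 One_nat_def gr0I not_numeral_le_zero power_Suc)
  then have r1: "r ^ (q - 1) = 1" using False by simp
  obtain k where k: "q = 2 * k + 1" using odd_q by (elim oddE)
  have "(CARD('a) - 1) div 2 = (q - 1) * (k + 1)"
    by (simp add: card_a k power2_eq_square algebra_simps)
  then have "r ^ ((CARD('a) - 1) div 2) = 1"
    by (simp only: power_mult r1 power_one)
  then show ?thesis
    using odd_q by (intro square_criterion two_neq_0) (auto simp: card_a)
qed auto

text \<open>1 and c are independent over \<open>K\<close>, so their q^2 combinations are distinct
  and exhaust the field.\<close>

lemma K_decomposition:
  assumes c: "c \<notin> K"
  obtains s t where "s \<in> K" "t \<in> K" "z = s + t * c"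
proof -
  have "inj_on (\<lambda>(s, t). s + t * c) (K \<times> K)"
  proof (rule inj_onI, clarify)
    fix s t s' t' assume *: "s \<in> K" "t \<in> K" "s' \<in> K" "t' \<in> K" "s + t * c = s' + t' * c"
    have "t = t'"
    proof (rule ccontr)
      assume ne: "t \<noteq> t'"
      have "c * (t - t') = s' - s" using *(5) by (simp add: algebra_simps)
      then have "c = (s' + - s) / (t + - t')" using ne by (simp add: eq_divide_eq)
      then show False using c * by (metis K_add K_minus K_div)
    qed
    then show "s = s' \<and> t = t'" using * by simp
  qed
  then have "card ((\<lambda>(s, t). s + t * c) ` (K \<times> K)) = CARD('a)"
    by (simp add: card_image card_cartesian_product card_K card_a power2_eq_square)
  then have "(\<lambda>(s, t). s + t * c) ` (K \<times> K) = UNIV"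
    by (intro card_subset_eq) auto
  then have "z \<in> (\<lambda>(s, t). s + t * c) ` (K \<times> K)" by simp
  then show thesis using that by auto
qed

subsection \<open>The trace and the additive character\<close>

text \<open>The absolute trace, kept inside \<open>'a\<close>: the prime field appears as 0, 1,
  -1.\<close>

definition tr :: "'a \<Rightarrow> 'a" where
  "tr x = (\<Sum>i<2 * m. x ^ 3 ^ i)"

lemma tr_add: "tr (x + y) = tr x + tr y"
  by (simp add: tr_def frob_add sum.distrib)

lemma tr_0: "tr 0 = 0"
  by (simp add: tr_def power_0_left)

lemma tr_minus: "tr (- x) = - tr x"
  using tr_add[of x "- x"] by (simp add: tr_0 eq_neg_iff_add_eq_0 add.commute)

lemma tr_diff: "tr (x - y) = tr x - tr y"
  using tr_add[of x "- y"] by (simp add: tr_minus)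

text \<open>Cubing shifts the summands cyclically, by Fermat.\<close>

lemma tr_cube: "tr x ^ 3 = tr x"
proof -
  let ?f = "\<lambda>i. x ^ 3 ^ i"
  have "tr x ^ 3 = (\<Sum>i<2 * m. ?f i ^ 3)"
    unfolding tr_def by (rule freshmans_dream_sum) (simp_all add: char3)
  also have "\<dots> = (\<Sum>i<2 * m. ?f (Suc i))"
    by (simp only: power_Suc2 power_mult)
  finally have cube: "tr x ^ 3 = (\<Sum>i<2 * m. ?f (Suc i))" .
  have "?f 0 + (\<Sum>i<2 * m. ?f (Suc i)) = (\<Sum>i<2 * m. ?f i) + ?f (2 * m)"
    using sum.lessThan_Suc_shift[of ?f "2 * m"] by (simp only: sum.lessThan_Suc)
  moreover have "?f (2 * m) = x"
    using finite_field_fermat[of x] by (simp only: card_3)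
  ultimately have "(\<Sum>i<2 * m. ?f (Suc i)) = (\<Sum>i<2 * m. ?f i)"
    by (simp only: power_0 power_one_right add.commute add_left_cancel)
  with cube show ?thesis by (simp only: tr_def)
qed

lemma tr_cases: "tr x = 0 \<or> tr x = 1 \<or> tr x = - 1"
proof -
  have "tr x * (tr x - 1) * (tr x + 1) = tr x ^ 3 - tr x"
    by (simp add: algebra_simps power3_eq_cube)
  then have "tr x * (tr x - 1) * (tr x + 1) = 0" by (simp add: tr_cube)
  then show ?thesis by (auto simp: eq_neg_iff_add_eq_0)
qed

lemma tr_scale:
  assumes "c = 0 \<or> c = 1 \<or> c = - 1"
  shows "tr (c * x) = c * tr x"
  using assms by (auto simp: tr_0 tr_minus)

text \<open>The trace is given by a nonzero polynomial whose degree is smaller than the order of the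
  field.\<close>

lemma tr_nontrivial: "\<exists>x. tr x \<noteq> 0"
proof (rule ccontr)
  assume "\<not> ?thesis"
  then have all: "tr x = 0" for x by auto
  define P :: "'a poly" where "P = (\<Sum>i<2 * m. monom 1 (3 ^ i))"
  have "coeff P 1 = (\<Sum>i<2 * m. if i = 0 then 1 else 0)"
    unfolding P_def coeff_sum by (intro sum.cong) auto
  also have "\<dots> = 1" using m1 by simp
  finally have "P \<noteq> 0" by (metis coeff_0 zero_neq_one)
  have "degree P \<le> 3 ^ (2 * m - 1)" unfolding P_def
    by (intro degree_sum_le) (auto intro!: order_trans[OF degree_monom_le] power_increasing)
  moreover have "{x. poly P x = 0} = UNIV"
    using all by (simp add: P_def poly_sum poly_monom tr_def)
  ultimately have "CARD('a) \<le> 3 ^ (2 * m - 1)"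
    using card_poly_roots_bound[OF \<open>P \<noteq> 0\<close>] by simp
  moreover have "(3::nat) ^ (2 * m - 1) < 3 ^ (2 * m)"
    using m1 by (intro power_strict_increasing) auto
  ultimately show False unfolding card_3 by linarith
qed

lemma tr_nontrivial_mult: "d \<noteq> 0 \<Longrightarrow> \<exists>y. tr (d * y) \<noteq> 0"
  using tr_nontrivial by (metis nonzero_mult_div_cancel_left times_divide_eq_right)

text \<open>The last m conjugates of x are the first m conjugates of x^q = -x, so the two halves
  cancel.\<close>

lemma tr_eq_0_if_frob_eq_minus:
  assumes "x ^ q = - x"
  shows "tr x = 0"
proof -
  have "{..<2 * m} = {..<m} \<union> {m..<2 * m}" by auto
  then have "tr x = (\<Sum>i<m. x ^ 3 ^ i) + (\<Sum>i=m..<2 * m. x ^ 3 ^ i)"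
    by (simp add: tr_def sum.union_disjoint ivl_disj_int)
  also have "(\<Sum>i=m..<2 * m. x ^ 3 ^ i) = (\<Sum>i<m. x ^ 3 ^ (m + i))"
    by (intro sum.reindex_bij_witness[of _ "\<lambda>i. m + i" "\<lambda>i. i - m"]) auto
  also have "\<dots> = (\<Sum>i<m. (x ^ q) ^ 3 ^ i)"
    by (simp add: q_def power_add power_mult)
  also have "\<dots> = - (\<Sum>i<m. x ^ 3 ^ i)"
    by (simp add: assms power_minus_odd sum_negf)
  finally show ?thesis by simp
qed

text \<open>The values are the cube roots of unity 1, \<omega> and \<omega>^2 = 1 +
  \<omega>.\<close>

definition chi :: "'a \<Rightarrow> gf4" where
  "chi x = (if tr x = 0 then 1 else if tr x = 1 then GF4 0 1 else GF4 1 1)"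

lemma chi_eq_1_iff: "chi x = 1 \<longleftrightarrow> tr x = 0"
  by (simp add: chi_def one_gf4_def)

lemma chi_nonzero: "chi x \<noteq> 0"
  by (simp add: chi_def one_gf4_def zero_gf4_def)

lemma chi_add: "chi (x + y) = chi x * chi y"
proof -
  have "(1::'a) + 1 = - 1" using two_eq by simp
  moreover have "(- 1::'a) + - 1 = 1"
    using calculation by (metis minus_add_distrib minus_minus)
  moreover have "(- 1 :: 'a) \<noteq> 1" using neg_eq_iff[of 1] by simp
  ultimately show ?thesis
    using tr_cases[of x] tr_cases[of y] by (auto simp: chi_def tr_add one_gf4_def)
qed

lemma chi_0: "chi 0 = 1"
  by (simp add: chi_eq_1_iff tr_0)

lemma sum_chi_eq_0:
  assumes y0: "chi (d * y0) \<noteq> 1"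
    and A: "\<And>y. y \<in> A \<Longrightarrow> y + y0 \<in> A" "\<And>y. y \<in> A \<Longrightarrow> y - y0 \<in> A"
  shows "(\<Sum>y\<in>A. chi (d * y)) = 0"
proof -
  have "(\<Sum>y\<in>A. chi (d * y)) = (\<Sum>y\<in>A. chi (d * (y + y0)))"
    using A by (intro sum.reindex_bij_witness[of _ "\<lambda>y. y + y0" "\<lambda>y. y - y0"]) auto
  also have "\<dots> = chi (d * y0) * (\<Sum>y\<in>A. chi (d * y))"
    by (simp add: distrib_left chi_add sum_distrib_left mult.commute)
  finally show ?thesis using y0 by simp
qed

lemma sum_chi_UNIV: "d \<noteq> 0 \<Longrightarrow> (\<Sum>y\<in>UNIV. chi (d * y)) = 0"
  using tr_nontrivial_mult[of d] by (auto intro: sum_chi_eq_0 simp: chi_eq_1_iff)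

lemma quadratic_sum_chi:
  assumes "\<gamma> \<noteq> 0"
  shows "(\<Sum>u\<in>UNIV. chi (- (\<kappa> * u) - \<gamma> * u\<^sup>2)) = chi (\<kappa>\<^sup>2 / \<gamma>)"
proof -
  \<comment> \<open>Completing the square calls for the shift -\<kappa>/(2\<gamma>), which is
    \<kappa>/\<gamma> because 2 = -1. The linear terms then form a multiple of 3, and what remains
    is even in u.\<close>
  define c where "c = \<kappa> / \<gamma>"
  have c: "\<kappa> = \<gamma> * c" using assms by (simp add: c_def)
  have "(\<Sum>u\<in>UNIV. chi (- (\<kappa> * u) - \<gamma> * u\<^sup>2))
      = (\<Sum>u\<in>UNIV. chi (- (\<kappa> * (u + c)) - \<gamma> * (u + c)\<^sup>2))"
    by (intro sum.reindex_bij_witness[of _ "\<lambda>u. u + c" "\<lambda>u. u - c"]) auto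
  also have "\<dots> = (\<Sum>u\<in>UNIV. chi (- \<gamma> * u\<^sup>2 + \<kappa>\<^sup>2 / \<gamma>))"
  proof (rule sum.cong)
    fix u
    have "- (\<kappa> * (u + c)) - \<gamma> * (u + c)\<^sup>2 = - \<gamma> * u\<^sup>2 + \<gamma> * c\<^sup>2 - 3 * (\<gamma> * c * (u + c))"
      by (simp add: c algebra_simps power2_eq_square)
    also have "\<gamma> * c\<^sup>2 = \<kappa>\<^sup>2 / \<gamma>" using assms by (simp add: c power2_eq_square)
    finally show "chi (- (\<kappa> * (u + c)) - \<gamma> * (u + c)\<^sup>2) = chi (- \<gamma> * u\<^sup>2 + \<kappa>\<^sup>2 / \<gamma>)"
      by (simp add: three_eq_0)
  qed simp
  also have "\<dots> = chi (\<kappa>\<^sup>2 / \<gamma>)"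
    by (subst sum_even_function_gf4) (auto simp: two_neq_0)
  finally show ?thesis .
qed

text \<open>The translates of the kernel by 0, s and -s are disjoint subsets of \<open>A\<close>.
  Allowing any additive subgroup \<open>A\<close> lets the lemma be applied again inside a
  kernel.\<close>

lemma card_tr_kernel:
  assumes s: "s \<in> A" "tr (s * g) \<noteq> 0"
    and A: "\<And>x y. x \<in> A \<Longrightarrow> y \<in> A \<Longrightarrow> x + y \<in> A" "\<And>x. x \<in> A \<Longrightarrow> - x \<in> A"
  shows "3 * card {r \<in> A. tr (r * g) = 0} \<le> card A"
proof -
  define B where "B = {r \<in> A. tr (r * g) = 0}"
  define F where "F = (\<lambda>(c, r). c * s + r)"
  have "inj_on F ({0, 1, - 1} \<times> B)"
  proof (rule inj_onI, clarify)
    fix c r c' r'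
    assume c: "c \<in> {0, 1, - 1}" "c' \<in> {0, 1, - 1}" and r: "r \<in> B" "r' \<in> B"
      and eq: "F (c, r) = F (c', r')"
    have "tr (F (c, r) * g) = c * tr (s * g)" if "c \<in> {0, 1, - 1}" "r \<in> B" for c r
      using that tr_scale[of c "s * g"] by (simp add: F_def B_def distrib_right tr_add mult.assoc)
    then have "c = c'" using c r eq s by (metis mult_right_cancel)
    then show "c = c' \<and> r = r'" using eq by (simp add: F_def)
  qed
  moreover have "F ` ({0, 1, - 1} \<times> B) \<subseteq> A"
    using s A(1) A(1)[OF A(2)[OF s(1)]] by (auto simp: F_def B_def)
  ultimately have "card ({0, 1, - 1 :: 'a} \<times> B) \<le> card A"
    by (intro card_inj_on_le) auto
  moreover have "card {0, 1, - 1 :: 'a} = 3"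
    using neg_eq_iff[of 1] by auto
  ultimately show ?thesis by (simp add: card_cartesian_product B_def)
qed

lemma card_common_tr_kernel:
  assumes g: "g1 \<noteq> 0" "g2 \<noteq> 0" "g2 \<noteq> g1" "g2 \<noteq> - g1"
  shows "9 * card {r. tr (r * g1) = 0 \<and> tr (r * g2) = 0} \<le> q\<^sup>2"
proof -
  define K1 where "K1 = {r. tr (r * g1) = 0}"
  obtain s1 where "tr (g1 * s1) \<noteq> 0" using tr_nontrivial_mult g by blast
  then have s1: "tr (s1 * g1) \<noteq> 0" by (simp add: mult.commute)
  have 1: "3 * card K1 \<le> q\<^sup>2"
    using card_tr_kernel[of s1 UNIV g1] s1 by (simp add: K1_def card_a)
  obtain r1 where r1: "tr (r1 * g1) = 1"
    using s1 tr_cases[of "s1 * g1"] by (metis minus_minus minus_mult_left tr_minus)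
  have "\<exists>s\<in>K1. tr (s * g2) \<noteq> 0"
  proof (rule ccontr)
    assume "\<not> ?thesis"
    then have sub: "tr (r * g2) = 0" if "tr (r * g1) = 0" for r
      using that by (auto simp: K1_def)
    define c where "c = tr (r1 * g2)"
    have c: "c = 0 \<or> c = 1 \<or> c = - 1" unfolding c_def by (rule tr_cases)
    \<comment> \<open>Subtracting a multiple of \<open>r1\<close> moves any r into
      \<open>K1\<close>, so the second functional would be c times the first.\<close>
    have "tr ((g2 - c * g1) * r) = 0" for r
    proof -
      define e where "e = tr (r * g1)"
      have e: "e = 0 \<or> e = 1 \<or> e = - 1" unfolding e_def by (rule tr_cases)
      have *: "tr ((r - e * r1) * g) = tr (r * g) - e * tr (r1 * g)" for g
        using tr_scale[OF e, of "r1 * g"] by (simp add: left_diff_distrib tr_diff mult.assoc)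
      have "tr ((r - e * r1) * g2) = 0"
        by (rule sub) (simp only: * r1, simp add: e_def)
      then have "tr (r * g2) = e * c" by (simp add: * c_def)
      moreover have "tr (c * (r * g1)) = c * e"
        using tr_scale[OF c] by (simp add: e_def)
      moreover have "(g2 - c * g1) * r = r * g2 - c * (r * g1)"
        by (simp add: algebra_simps)
      ultimately show ?thesis
        by (simp add: tr_diff mult.commute)
    qed
    then have "g2 = c * g1" using tr_nontrivial_mult[of "g2 - c * g1"] by auto
    then show False using c g by auto
  qed
  then obtain s where s: "s \<in> K1" "tr (s * g2) \<noteq> 0" by blast
  have "3 * card {r \<in> K1. tr (r * g2) = 0} \<le> card K1"
    using s by (rule card_tr_kernel) (auto simp: K1_def distrib_right tr_add tr_minus)
  then show ?thesis using 1 by (simp add: K1_def)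
qed

subsection \<open>Blocks of the unital\<close>

lemma theta_nonzero: "\<theta> \<noteq> 0"
proof
  assume "\<theta> = 0"
  then have "\<theta> ^ (q + 1) = 0\<^sup>2" by simp
  then show False using nonsquare K_0 unfolding nonsquare_in_def by blast
qed

definition M :: "'a set" where
  "M = (\<lambda>t. t * \<theta>) ` K"

lemma card_M: "card M = q"
  unfolding M_def using card_K theta_nonzero by (subst card_image) (auto simp: inj_on_def)

lemma M_0: "0 \<in> M"
  using K_0 by (force simp: M_def)

lemma M_I: "t \<in> K \<Longrightarrow> t * \<theta> \<in> M"
  unfolding M_def by (rule imageI)

lemma M_E:
  assumes "x \<in> M" obtains t where "t \<in> K" "x = t * \<theta>"
  using assms by (auto simp: M_def)

lemma M_add: "x \<in> M \<Longrightarrow> y \<in> M \<Longrightarrow> x + y \<in> M"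
  by (metis M_E M_I K_add distrib_right)

lemma M_minus: "x \<in> M \<Longrightarrow> - x \<in> M"
  by (metis M_E M_I K_minus mult_minus_left)

lemma M_diff: "x \<in> M \<Longrightarrow> y \<in> M \<Longrightarrow> x - y \<in> M"
  using M_add[of x "- y"] M_minus[of y] by simp

lemma M_scale: "s \<in> K \<Longrightarrow> x \<in> M \<Longrightarrow> s * x \<in> M"
  by (metis M_E M_I K_mult mult.assoc)

lemma M_scale_iff:
  assumes s: "s \<in> K" "s \<noteq> 0"
  shows "s * x \<in> M \<longleftrightarrow> x \<in> M"
proof
  assume "s * x \<in> M"
  then have "(1 / s) * (s * x) \<in> M" by (rule M_scale[OF K_div[OF K_1 s(1)]])
  then show "x \<in> M" using s by simp
qed (simp add: M_scale s)

lemma M_diff_right_iff: "y \<in> M \<Longrightarrow> x - y \<in> M \<longleftrightarrow> x \<in> M"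
  using M_diff[of x y] M_add[of "x - y" y] by auto

text \<open>Taking norms in u^2 = t\<theta> would make \<theta>^(q+1) the square of an element of
  \<open>K\<close>. Geometrically, the lines with b in \<open>M\<close> are tangents.\<close>

lemma square_in_M_iff: "u\<^sup>2 \<in> M \<longleftrightarrow> u = 0"
proof
  assume "u\<^sup>2 \<in> M"
  then obtain t where t: "t \<in> K" "u\<^sup>2 = t * \<theta>" by (auto simp: M_def)
  show "u = 0"
  proof (rule ccontr)
    assume "u \<noteq> 0"
    then have t0: "t \<noteq> 0" using t by auto
    have tq: "t ^ q = t" using t K_iff by simp
    have "(u ^ (q + 1))\<^sup>2 = (u\<^sup>2) ^ (q + 1)" by (simp only: mult.commute flip: power_mult)
    also have "\<dots> = t\<^sup>2 * \<theta> ^ (q + 1)"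
      by (simp only: t power_mult_distrib) (simp add: tq power2_eq_square)
    finally have "\<theta> ^ (q + 1) = (u ^ (q + 1) / t)\<^sup>2" using t0 by (simp only: power_divide) simp
    then show False
      using nonsquare K_div[OF K_norm[of u] t(1)] unfolding nonsquare_in_def by blast
  qed
qed (simp add: M_0)

text \<open>For nonzero u, the square lies in exactly one coset \<open>r * b + M\<close> with r in
  \<open>K\<close> nonzero. Multiplication by a square root of r carries the class of 1 onto the
  class of r, so q - 1 classes of equal size partition q^2 - 1 elements.\<close>

lemma card_squares_in_coset:
  assumes b: "b \<notin> M"
  shows "card {u. u\<^sup>2 - b \<in> M} = q + 1"
proof -
  define S where "S = (\<lambda>r. {u. u\<^sup>2 - r * b \<in> M})"
  have uniq: "r = r'" if "r \<in> K" "r' \<in> K" "x - r * b \<in> M" "x - r' * b \<in> M" for r r' x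
  proof (rule ccontr)
    assume ne: "r \<noteq> r'"
    have "(r - r') * b = (x - r' * b) - (x - r * b)" by (simp add: algebra_simps)
    then have "(r - r') * b \<in> M" using M_diff[OF that(4,3)] by simp
    moreover have "r - r' \<in> K" using K_add[OF that(1) K_minus[OF that(2)]] by simp
    ultimately show False using M_scale_iff b ne by simp
  qed
  have cover: "UNIV - {0} = (\<Union>r\<in>K - {0}. S r)"
  proof (intro set_eqI iffI)
    fix u :: 'a assume u: "u \<in> UNIV - {0}"
    \<comment> \<open>1 and b/\<theta> form a basis over \<open>K\<close>; multiplying by \<theta>
      splits the field into \<open>M\<close> and the multiples of b.\<close>
    have "b / \<theta> \<notin> K" using b M_I[of "b / \<theta>"] theta_nonzero by auto
    then obtain s r where sr: "s \<in> K" "r \<in> K" "u\<^sup>2 / \<theta> = s + r * (b / \<theta>)"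
      by (rule K_decomposition)
    define y where "y = s * \<theta>"
    have "u\<^sup>2 = u\<^sup>2 / \<theta> * \<theta>" using theta_nonzero by simp
    also have "\<dots> = r * b + y"
      unfolding sr(3) using theta_nonzero by (simp add: y_def distrib_right add.commute)
    finally have r: "r \<in> K" "y \<in> M" "u\<^sup>2 = r * b + y"
      using sr(1,2) M_I by (simp_all add: y_def)
    moreover have "r \<noteq> 0" using u r square_in_M_iff[of u] by auto
    moreover have "u \<in> S r" unfolding S_def using r by simp
    ultimately show "u \<in> (\<Union>r\<in>K - {0}. S r)" by blast
  next
    fix u assume "u \<in> (\<Union>r\<in>K - {0}. S r)"
    then obtain r where r: "r \<in> K" "r \<noteq> 0" "u\<^sup>2 - r * b \<in> M" by (auto simp: S_def)
    have "u \<noteq> 0"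
    proof
      assume "u = 0"
      then have "r * b \<in> M" using M_minus[OF r(3)] by simp
      then show False using M_scale_iff r b by simp
    qed
    then show "u \<in> UNIV - {0}" by simp
  qed
  have card_S: "card (S r) = card (S 1)" if r: "r \<in> K - {0}" for r
  proof -
    obtain j where j: "r = j\<^sup>2" using K_square r by blast
    then have j0: "j \<noteq> 0" using r by auto
    have *: "(j * u)\<^sup>2 - r * b = r * (u\<^sup>2 - 1 * b)" for u
      by (simp add: j power_mult_distrib right_diff_distrib)
    have iff: "j * u \<in> S r \<longleftrightarrow> u \<in> S 1" for u
      unfolding S_def mem_Collect_eq * using r by (intro M_scale_iff) auto
    have "x / j \<in> S 1" if "x \<in> S r" for x
      using that iff[of "x / j"] j0 by simp
    then have "bij_betw (\<lambda>u. j * u) (S 1) (S r)"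
      using j0 iff by (intro bij_betw_byWitness[where f' = "\<lambda>u. u / j"]) (simp_all add: image_subset_iff)
    then show ?thesis by (simp add: bij_betw_same_card)
  qed
  have "q\<^sup>2 - 1 = card (UNIV - {0 :: 'a})"
    by (simp add: card_a)
  also have "\<dots> = (\<Sum>r\<in>K - {0}. card (S r))"
  proof -
    have "S r \<inter> S r' = {}" if "r \<in> K - {0}" "r' \<in> K - {0}" "r \<noteq> r'" for r r'
      using that uniq[of r r'] unfolding S_def by blast
    then show ?thesis unfolding cover by (intro card_UN_disjoint) auto
  qed
  also have "\<dots> = (\<Sum>r\<in>K - {0}. card (S 1))"
    by (intro sum.cong card_S refl)
  also have "\<dots> = (q - 1) * card (S 1)"
    by (simp add: card_K K_0)
  finally have "(q - 1) * (q + 1) = (q - 1) * card (S 1)"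
    by (simp add: power2_eq_square algebra_simps)
  then have "q + 1 = card (S 1)"
    unfolding nat_mult_eq_cancel_disj using q_ge by simp
  then show ?thesis by (simp add: S_def)
qed

abbreviation "U \<equiv> unital_U q \<theta>"
abbreviation "parabola \<equiv> line_L (\<lambda>x :: 'a. x\<^sup>2)"

lemma Affine_in_U: "Affine x y \<in> U \<longleftrightarrow> y \<in> M"
  by (auto simp: unital_U_def M_def)

lemma parabola_block:
  assumes "b \<notin> M"
  shows "U \<inter> parabola a b \<in> blocks q (\<lambda>x. x\<^sup>2) U"
proof -
  let ?A = "{x. (x + a)\<^sup>2 - b \<in> M}"
  have "U \<inter> parabola a b = (\<lambda>x. Affine x ((x + a)\<^sup>2 - b)) ` ?A"
    by (auto simp: line_L_def Affine_in_U) (auto simp: unital_U_def)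
  then have "card (U \<inter> parabola a b) = card ?A"
    by (simp add: card_image inj_on_def)
  also have "\<dots> = card {u. u\<^sup>2 - b \<in> M}"
    by (intro bij_betw_same_card[of "\<lambda>x. x + a"] bij_betw_byWitness[where f' = "\<lambda>u. u - a"]) auto
  finally show ?thesis
    using card_squares_in_coset[OF assms] by (auto simp: blocks_def plane_lines_def)
qed

lemma vertical_block: "U \<inter> line_N a \<in> blocks q (\<lambda>x. x\<^sup>2) U"
proof -
  have "U \<inter> line_N a = insert (At_Infinity None) (Affine a ` M)"
    by (auto simp: line_N_def Affine_in_U) (auto simp: unital_U_def)
  moreover have "card (Affine a ` M) = q"
    by (simp add: card_image inj_on_def card_M)
  ultimately have "card (U \<inter> line_N a) = q + 1"
    by (simp add: card_insert_if image_iff)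
  then show ?thesis by (auto simp: blocks_def plane_lines_def)
qed

subsection \<open>Characters in the code\<close>

lemma chi_eq_iff: "chi x = chi y \<longleftrightarrow> tr (x - y) = 0"
  using chi_add[of "x - y" y] chi_nonzero[of y] by (auto simp flip: chi_eq_1_iff)

text \<open>Bits are read in \<open>gf4\<close> and the points at infinity are forgotten. Losing
  coordinates is harmless for a lower bound.\<close>

definition embed :: "bit ^ 'a point \<Rightarrow> gf4 ^ ('a \<times> 'a)" where
  "embed v = (\<chi> p. of_bool (v $ Affine (fst p) (snd p) = 1))"

lemma embed_add: "embed (v + w) = embed v + embed w"
proof -
  have "of_bool (a + b = 1) = (of_bool (a = 1) + of_bool (b = 1) :: gf4)" for a b :: bit
    by (cases a; cases b) (simp_all add: gf4_add_self)
  then show ?thesis by (simp add: embed_def vec_eq_iff)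
qed

definition code4 :: "(gf4 ^ ('a \<times> 'a)) set" where
  "code4 = vec.span (embed ` char_vec ` blocks q (\<lambda>x. x\<^sup>2) U)"

definition wave :: "'a \<Rightarrow> 'a \<Rightarrow> gf4 ^ ('a \<times> 'a)" where
  "wave \<kappa> \<gamma> = (\<chi> p. if snd p \<in> M then chi (\<kappa> * fst p + \<gamma> * snd p) else 0)"

definition P :: "'a set" where
  "P = {\<gamma>. \<forall>y\<in>M. tr (\<gamma> * y) = 0}"

lemma wave_eq_iff: "wave \<kappa> \<gamma> = wave \<kappa>' \<gamma>' \<longleftrightarrow> \<kappa> = \<kappa>' \<and> \<gamma> - \<gamma>' \<in> P"
proof
  assume eq: "wave \<kappa> \<gamma> = wave \<kappa>' \<gamma>'"
  have *: "tr ((\<kappa> - \<kappa>') * x + (\<gamma> - \<gamma>') * y) = 0" if "y \<in> M" for x y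
  proof -
    have "wave \<kappa> \<gamma> $ (x, y) = wave \<kappa>' \<gamma>' $ (x, y)" by (simp only: eq)
    then have "tr ((\<kappa> * x + \<gamma> * y) - (\<kappa>' * x + \<gamma>' * y)) = 0"
      using that by (simp add: wave_def chi_eq_iff)
    then show ?thesis by (simp add: algebra_simps)
  qed
  have "\<kappa> - \<kappa>' = 0" using *[OF M_0] tr_nontrivial_mult[of "\<kappa> - \<kappa>'"] by auto
  moreover have "\<gamma> - \<gamma>' \<in> P" using *[of _ 0] by (simp add: P_def)
  ultimately show "\<kappa> = \<kappa>' \<and> \<gamma> - \<gamma>' \<in> P" by simp
next
  assume "\<kappa> = \<kappa>' \<and> \<gamma> - \<gamma>' \<in> P"
  then show "wave \<kappa> \<gamma> = wave \<kappa>' \<gamma>'"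
    by (auto simp: wave_def vec_eq_iff chi_eq_iff P_def left_diff_distrib)
qed

text \<open>Orthogonality of characters: \<open>\<phi>\<close> pairs with the inverse of the chosen
  character. It kills every other wave, and on the chosen one it counts q^3 points, an odd
  number.\<close>

lemma independent_waves: "vec.independent {wave \<kappa> \<gamma> |\<kappa> \<gamma>. True}"
proof
  let ?R = "{wave \<kappa> \<gamma> |\<kappa> \<gamma>. True}"
  assume "vec.dependent ?R"
  then obtain \<kappa> \<gamma> where dep: "wave \<kappa> \<gamma> \<in> vec.span (?R - {wave \<kappa> \<gamma>})"
    unfolding vec.dependent_def by blast
  define \<phi> :: "gf4 ^ ('a \<times> 'a) \<Rightarrow> gf4" where
    "\<phi> f = (\<Sum>x\<in>UNIV. \<Sum>y\<in>M. chi (- (\<kappa> * x + \<gamma> * y)) * f $ (x, y))" for f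
  have \<phi>_lin: "\<phi> (c *s v + w) = c * \<phi> v + \<phi> w" for c v w
    by (simp add: \<phi>_def distrib_left sum.distrib sum_distrib_left mult.left_commute)
  have \<phi>_wave: "\<phi> (wave \<kappa>' \<gamma>')
      = (\<Sum>x\<in>UNIV. chi ((\<kappa>' - \<kappa>) * x)) * (\<Sum>y\<in>M. chi ((\<gamma>' - \<gamma>) * y))" for \<kappa>' \<gamma>'
    unfolding \<phi>_def sum_product
  proof (intro sum.cong refl)
    fix x y assume "y \<in> M"
    then show "chi (- (\<kappa> * x + \<gamma> * y)) * wave \<kappa>' \<gamma>' $ (x, y)
        = chi ((\<kappa>' - \<kappa>) * x) * chi ((\<gamma>' - \<gamma>) * y)"
      by (simp add: wave_def algebra_simps flip: chi_add)
  qed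
  have "\<phi> v = 0" if "v \<in> vec.span (?R - {wave \<kappa> \<gamma>})" for v
    using that
  proof (induction rule: vec.span_induct_alt)
    case base
    show ?case by (simp add: \<phi>_def)
  next
    case (step c w y)
    then obtain \<kappa>' \<gamma>' where w: "w = wave \<kappa>' \<gamma>'" "w \<noteq> wave \<kappa> \<gamma>" by blast
    have "\<phi> w = 0"
    proof (cases "\<kappa>' = \<kappa>")
      case True
      then have "\<gamma>' - \<gamma> \<notin> P" using w wave_eq_iff by simp
      then obtain y0 where "y0 \<in> M" "chi ((\<gamma>' - \<gamma>) * y0) \<noteq> 1"
        by (auto simp: P_def chi_eq_1_iff)
      then show ?thesis
        using sum_chi_eq_0[of "\<gamma>' - \<gamma>" y0 M] by (simp add: w(1) \<phi>_wave M_add M_diff)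
    next
      case False
      then show ?thesis using sum_chi_UNIV[of "\<kappa>' - \<kappa>"] by (simp add: w(1) \<phi>_wave)
    qed
    then show ?case using step by (simp add: \<phi>_lin)
  qed
  then have "\<phi> (wave \<kappa> \<gamma>) = 0" using dep by blast
  moreover have "\<phi> (wave \<kappa> \<gamma>) = 1"
    using odd_q by (simp add: \<phi>_wave chi_0 card_a card_M of_nat_gf4)
  ultimately show False by simp
qed

lemma embed_char_vec:
  "embed (char_vec B) $ (x, y) = of_bool (Affine x y \<in> B)"
  by (simp add: embed_def char_vec_def)

lemma code4_block: "B \<in> blocks q (\<lambda>x. x\<^sup>2) U \<Longrightarrow> embed (char_vec B) \<in> code4"
  unfolding code4_def by (intro vec.span_base imageI)

text \<open>Each affine point lies on one vertical line, so the weights \<chi>(\<kappa>a) are simply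
  the values of the wave.\<close>

lemma wave_0_in_code4: "wave \<kappa> 0 \<in> code4"
proof -
  have "wave \<kappa> 0 = (\<Sum>a\<in>UNIV. chi (\<kappa> * a) *s embed (char_vec (U \<inter> line_N a)))"
    by (auto simp: vec_eq_iff embed_char_vec wave_def Affine_in_U line_N_def if_distrib
        sum.delta cong: if_cong)
  then show ?thesis
    using code4_block[OF vertical_block]
    by (simp add: code4_def vec.span_sum vec.span_scale)
qed

lemma wave_in_code4:
  assumes "\<gamma> \<noteq> 0" "tr (\<kappa>\<^sup>2 / \<gamma>) \<noteq> 0"
  shows "wave \<kappa> \<gamma> \<in> code4"
proof -
  \<comment> \<open>The Gauss sum without its term at u = 0, which is the contribution of the
    tangents.\<close>
  define c where "c = chi (\<kappa>\<^sup>2 / \<gamma>) - 1"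
  define S where "S = (\<Sum>a\<in>UNIV. \<Sum>b\<in>- M.
    chi (- (\<kappa> * a) - \<gamma> * b) *s embed (char_vec (U \<inter> parabola a b)))"
  have "S \<in> code4"
    using code4_block[OF parabola_block] unfolding S_def code4_def
    by (intro vec.span_sum vec.span_scale) auto
  have "S $ (x, y) = c * wave \<kappa> \<gamma> $ (x, y)" for x y
  proof (cases "y \<in> M")
    case False
    then show ?thesis by (simp add: S_def embed_char_vec Affine_in_U wave_def)
  next
    case True
    have "S $ (x, y) = (\<Sum>a\<in>UNIV. \<Sum>b\<in>- M.
        chi (- (\<kappa> * a) - \<gamma> * b) * of_bool (b = (x + a)\<^sup>2 - y))"
      using True unfolding S_def
      by (auto simp: embed_char_vec Affine_in_U line_L_def intro!: sum.cong)
    \<comment> \<open>For given a, only b = (x + a)^2 - y puts the point on the line. As y is in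
      \<open>M\<close>, this b lies outside \<open>M\<close> unless x + a = 0.\<close>
    also have "\<dots> = (\<Sum>a\<in>UNIV. if x + a = 0 then 0 else chi (- (\<kappa> * a) - \<gamma> * ((x + a)\<^sup>2 - y)))"
      using True by (intro sum.cong)
        (auto simp: M_diff_right_iff square_in_M_iff of_bool_def if_distrib cong: if_cong)
    also have "\<dots> = (\<Sum>u\<in>UNIV. if u = 0 then 0
        else chi (\<kappa> * x + \<gamma> * y) * chi (- (\<kappa> * u) - \<gamma> * u\<^sup>2))"
      by (intro sum.reindex_bij_witness[of _ "\<lambda>u. u - x" "\<lambda>a. x + a"])
        (auto simp: algebra_simps simp flip: chi_add)
    also have "\<dots> = chi (\<kappa> * x + \<gamma> * y) * (\<Sum>u\<in>UNIV - {0}. chi (- (\<kappa> * u) - \<gamma> * u\<^sup>2))"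
      unfolding sum_distrib_left by (intro sum.mono_neutral_cong_right) auto
    also have "(\<Sum>u\<in>UNIV - {0}. chi (- (\<kappa> * u) - \<gamma> * u\<^sup>2)) = c"
      using quadratic_sum_chi[OF assms(1), of \<kappa>] sum.remove[of UNIV 0 "\<lambda>u. chi (- (\<kappa> * u) - \<gamma> * u\<^sup>2)"]
      by (simp add: c_def chi_0 eq_diff_eq add.commute)
    finally show ?thesis using True by (simp add: wave_def mult.commute)
  qed
  then have "S = c *s wave \<kappa> \<gamma>" by (simp add: vec_eq_iff)
  moreover have "c \<noteq> 0" using assms(2) by (simp add: c_def chi_eq_1_iff)
  ultimately have "wave \<kappa> \<gamma> = inverse c *s S" by simp
  then show ?thesis using \<open>S \<in> code4\<close> unfolding code4_def by (metis vec.span_scale)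
qed

section \<open>The annihilator of M and the count of good pairs\<close>

lemma P_nontrivial: "\<exists>l\<in>P. l \<noteq> 0"
proof -
  have "card K < CARD('a)" using q_ge by (simp add: card_K card_a power2_eq_square)
  then have "K \<noteq> UNIV" by auto
  then obtain x where x: "x \<notin> K" by blast
  \<comment> \<open>Since z^q = -z, all \<open>K\<close>-multiples of z have trace 0; dividing z by
    \<theta> converts this into annihilation of \<open>M\<close>.\<close>
  define z where "z = x ^ q - x"
  have z: "z ^ q = - z" by (simp add: z_def frob_q_diff frob_q_frob_q)
  have "tr (z / \<theta> * y) = 0" if y: "y \<in> M" for y
  proof -
    obtain t where t: "t \<in> K" "y = t * \<theta>" using y by (rule M_E)
    have "(z * t) ^ q = - (z * t)" using t(1) by (simp add: power_mult_distrib z K_iff)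
    then have "tr (z * t) = 0" by (rule tr_eq_0_if_frob_eq_minus)
    then show ?thesis using theta_nonzero by (simp add: t(2))
  qed
  moreover have "z / \<theta> \<noteq> 0" using x theta_nonzero by (simp add: z_def K_iff)
  ultimately show ?thesis unfolding P_def by blast
qed

lemma P_minus: "x \<in> P \<Longrightarrow> - x \<in> P"
  by (simp add: P_def tr_minus)

text \<open>If \<gamma>/l were outside \<open>K\<close>, then l and \<gamma> would span the field
  over \<open>K\<close>, and every multiple of l\<theta> would have trace 0.\<close>

lemma card_P_le: "card P \<le> q"
proof -
  obtain l where l: "l \<in> P" "l \<noteq> 0" using P_nontrivial by blast
  have "\<gamma> / l \<in> K" if \<gamma>: "\<gamma> \<in> P" for \<gamma>
  proof (rule ccontr)
    define c where "c = \<gamma> / l"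
    assume "\<gamma> / l \<notin> K"
    then have c: "c \<notin> K" by (simp add: c_def)
    have "tr (l * \<theta> * z) = 0" for z
    proof -
      obtain s t where st: "s \<in> K" "t \<in> K" "z = s + t * c" using c by (rule K_decomposition)
      have "l * \<theta> * z = l * (s * \<theta>) + \<gamma> * (t * \<theta>)"
        using l(2) by (simp add: st(3) c_def field_simps)
      moreover have "tr (l * (s * \<theta>)) = 0" "tr (\<gamma> * (t * \<theta>)) = 0"
        using l(1) \<gamma> M_I st by (auto simp: P_def)
      ultimately show ?thesis by (simp add: tr_add)
    qed
    then show False using tr_nontrivial_mult[of "l * \<theta>"] l(2) theta_nonzero by auto
  qed
  then have "card P \<le> card K"
    using l(2) by (intro card_inj_on_le[of "\<lambda>\<gamma>. \<gamma> / l"]) (auto simp: inj_on_def)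
  then show ?thesis by (simp add: card_K)
qed

text \<open>
  A pair is good if \<open>wave\<close> takes the same value at some pair that is covered by
  \<open>wave_0_in_code4\<close> or \<open>wave_in_code4\<close>.
\<close>

definition good :: "('a \<times> 'a) set" where
  "good = {(\<kappa>, \<gamma>). \<gamma> \<in> P \<or> (\<exists>l\<in>P. \<gamma> + l \<noteq> 0 \<and> tr (\<kappa>\<^sup>2 / (\<gamma> + l)) \<noteq> 0)}"

lemma good_waves_in_code4: "case_prod wave ` good \<subseteq> code4"
proof clarify
  fix \<kappa> \<gamma> assume "(\<kappa>, \<gamma>) \<in> good"
  then consider "\<gamma> \<in> P" | l where "l \<in> P" "\<gamma> + l \<noteq> 0" "tr (\<kappa>\<^sup>2 / (\<gamma> + l)) \<noteq> 0"
    by (auto simp: good_def)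
  then show "wave \<kappa> \<gamma> \<in> code4"
  proof cases
    case 1
    then have "wave \<kappa> \<gamma> = wave \<kappa> 0" by (simp add: wave_eq_iff)
    then show ?thesis by (simp add: wave_0_in_code4)
  next
    case (2 l)
    have "wave \<kappa> \<gamma> = wave \<kappa> (\<gamma> + l)" using P_minus[OF 2(1)] by (simp add: wave_eq_iff)
    then show ?thesis using wave_in_code4[OF 2(2,3)] by simp
  qed
qed

text \<open>Along a fibre, \<kappa> is fixed and \<gamma> stays in one coset of
  \<open>P\<close>.\<close>

lemma card_good_le: "card good \<le> card P * card (case_prod wave ` good)"
proof (rule card_le_fibres)
  fix w assume "w \<in> case_prod wave ` good"
  then obtain \<kappa> \<gamma> where w: "w = wave \<kappa> \<gamma>" by auto
  have "inj_on (\<lambda>p. snd p - \<gamma>) {p \<in> good. case_prod wave p = w}"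
    by (auto simp: inj_on_def w wave_eq_iff)
  moreover have "(\<lambda>p. snd p - \<gamma>) ` {p \<in> good. case_prod wave p = w} \<subseteq> P"
    by (auto simp: w wave_eq_iff)
  ultimately show "card {p \<in> good. case_prod wave p = w} \<le> card P"
    by (rule card_inj_on_le) simp
qed simp

lemma card_bad_column:
  assumes \<gamma>: "\<gamma> \<notin> P"
  shows "9 * (card {\<kappa>. (\<kappa>, \<gamma>) \<notin> good} + 1) \<le> 2 * q\<^sup>2"
proof -
  obtain l where l: "l \<in> P" "l \<noteq> 0" using P_nontrivial by blast
  have P0: "0 \<in> P" by (simp add: P_def tr_0)
  have \<gamma>0: "\<gamma> \<noteq> 0" "\<gamma> + l \<noteq> 0"
    using \<gamma> P0 P_minus[OF l(1)] by (auto simp: add_eq_0_iff2)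
  define R where "R = {r. tr (r * (1 / \<gamma>)) = 0 \<and> tr (r * (1 / (\<gamma> + l))) = 0}"
  \<comment> \<open>Independence over the prime field also requires the ratio of the two reciprocals
    to differ from -1; in characteristic 3 that ratio would give \<gamma> = l, an element of
    \<open>P\<close>.\<close>
  have "\<gamma> + l \<noteq> - \<gamma>"
  proof
    assume "\<gamma> + l = - \<gamma>"
    then have "l = - 2 * \<gamma>" by (simp add: algebra_simps eq_neg_iff_add_eq_0)
    then have "l = \<gamma>" by (simp add: two_eq)
    then show False using l \<gamma> by simp
  qed
  then have "1 / (\<gamma> + l) \<noteq> - (1 / \<gamma>)" 
    using \<gamma>0 by (metis divide_minus_right inverse_eq_iff_eq inverse_eq_divide)
  then have R: "9 * card R \<le> q\<^sup>2"
    unfolding R_def using \<gamma>0 l by (intro card_common_tr_kernel) auto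
  have R0: "0 \<in> R" by (simp add: R_def tr_0)
  let ?B = "{\<kappa>. \<kappa>\<^sup>2 \<in> R}"
  \<comment> \<open>Zero is split off because it has a single square root; this improves 2|R| to
    2|R| - 1.\<close>
  have "card (?B - {0}) \<le> 2 * card (power2 ` (?B - {0}))"
    by (rule card_le_twice_card_squares) simp
  also have "\<dots> \<le> 2 * card (R - {0})"
    by (intro mult_left_mono card_mono) auto
  finally have "card (?B - {0}) \<le> 2 * card (R - {0})" .
  moreover have "card ?B = Suc (card (?B - {0}))" using R0 by (intro card.remove) auto
  moreover have "card R = Suc (card (R - {0}))" using R0 by (intro card.remove) auto
  ultimately have "card ?B + 1 \<le> 2 * card R" by linarith
  \<comment> \<open>A bad pair fails the trace test for both shifts 0 and l.\<close>
  moreover have "card {\<kappa>. (\<kappa>, \<gamma>) \<notin> good} \<le> card ?B"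
    using \<gamma>0 l(1) P0 by (intro card_mono) (force simp: good_def R_def)+
  ultimately show ?thesis using R by simp
qed

text \<open>Pairs with \<gamma> in \<open>P\<close> are good, so the column bound is summed over the
  complement of \<open>P\<close>.\<close>

lemma card_not_good: "9 * card (- good) + 9 * card (- P) \<le> 2 * q\<^sup>2 * card (- P)"
proof -
  have "- good = (\<lambda>(\<gamma>, \<kappa>). (\<kappa>, \<gamma>)) ` (SIGMA \<gamma>:- P. {\<kappa>. (\<kappa>, \<gamma>) \<notin> good})"
    by (auto simp: image_iff) (auto simp: good_def)
  then have "card (- good) = card (SIGMA \<gamma>:- P. {\<kappa>. (\<kappa>, \<gamma>) \<notin> good})"
    by (simp only:) (rule card_image, auto simp: inj_on_def)
  also have "\<dots> = (\<Sum>\<gamma>\<in>- P. card {\<kappa>. (\<kappa>, \<gamma>) \<notin> good})"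
    by (rule card_SigmaI) auto
  finally have "9 * card (- good) + 9 * card (- P)
      = (\<Sum>\<gamma>\<in>- P. 9 * (card {\<kappa>. (\<kappa>, \<gamma>) \<notin> good} + 1))"
    by (simp add: sum_distrib_left sum.distrib)
  also have "\<dots> \<le> (\<Sum>\<gamma>\<in>- P. 2 * q\<^sup>2)"
    by (intro sum_mono card_bad_column) auto
  finally show ?thesis by (simp add: mult.commute)
qed

lemma dim_binary_code_ge:
  "9 * real (vec.dim (binary_code q (\<lambda>x. x\<^sup>2) U)) \<ge> 7 * real q ^ 3 + 2 * real q ^ 2 + 9 * real q - 9"
proof -
  let ?W = "case_prod wave ` good"
  define n where "n = real (card ?W)"
  define p where "p = real (card P)"
  have "vec.independent ?W"
    by (rule vec.independent_mono[OF independent_waves]) auto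
  then have "card ?W \<le> vec.dim (char_vec ` blocks q (\<lambda>x. x\<^sup>2) U)"
    using good_waves_in_code4 unfolding code4_def
    by (intro card_independent_le_dim_bit[of embed] embed_add)
  then have n: "n \<le> real (vec.dim (binary_code q (\<lambda>x. x\<^sup>2) U))"
    by (simp add: n_def binary_code_def vec.dim_span)
  have q3: "real q \<ge> 3" using q_ge by simp
  have pq: "0 \<le> p" "p \<le> real q" using card_P_le by (auto simp: p_def)
  have cP: "real (card (- P)) = real q ^ 2 - p"
    using card_mono[of UNIV P] by (simp add: Compl_eq_Diff_UNIV card_Diff_subset card_a p_def of_nat_diff)
  have cg: "real (card (- good)) = real q ^ 4 - real (card good)"
    using card_mono[of UNIV good]
    by (simp add: Compl_eq_Diff_UNIV card_Diff_subset card_a of_nat_diff flip: power_add)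
  have "real (card good) \<le> p * n"
    using card_good_le by (simp add: p_def n_def flip: of_nat_mult)
  moreover have "9 * real (card (- good)) + 9 * real (card (- P)) \<le> 2 * real q ^ 2 * real (card (- P))"
    using card_not_good by (metis (mono_tags) of_nat_add of_nat_le_iff of_nat_mult of_nat_numeral of_nat_power)
  ultimately have "9 * (real q ^ 4 - p * n) + 9 * (real q ^ 2 - p) \<le> 2 * real q ^ 2 * (real q ^ 2 - p)"
    by (simp add: cP cg)
  then have main: "7 * real q ^ 4 + 9 * real q ^ 2 \<le> p * (9 * n - 2 * real q ^ 2 + 9)"
    by (simp add: algebra_simps power4_eq_xxxx power2_eq_square)
  \<comment> \<open>As \<open>p * T\<close> is positive, so is \<open>T\<close>; hence p may be
    raised to its bound q and a factor q cancelled.\<close>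
  define T where "T = 9 * n - 2 * real q ^ 2 + 9"
  have "0 < 7 * real q ^ 4 + 9 * real q ^ 2" using q3 by (intro add_pos_pos) auto
  then have "0 < p * T" using main by (simp add: T_def)
  then have "T > 0" using pq(1) by (simp add: zero_less_mult_iff)
  have "real q * (7 * real q ^ 3 + 9 * real q) = 7 * real q ^ 4 + 9 * real q ^ 2"
    by (simp add: algebra_simps power4_eq_xxxx power3_eq_cube power2_eq_square)
  also have "\<dots> \<le> p * T" using main by (simp add: T_def)
  also have "\<dots> \<le> real q * T" using pq(2) \<open>T > 0\<close> by (intro mult_right_mono) auto
  finally have "7 * real q ^ 3 + 9 * real q \<le> T" using q3 by simp
  then show ?thesis using n by (simp add: T_def)
qed

end

theorem corollary4p8:
  fixes m q :: nat and \<theta> :: "'a :: {field, finite}"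
  assumes "m \<ge> 1"
    and "q = 3 ^ m"
    and "CARD('a) = q ^ 2"
    and "nonsquare_in (subfield_of_order q) (\<theta> ^ (q + 1))"
  shows "real (vec.dim (binary_code q (\<lambda>x. x ^ 2) (unital_U q \<theta>))) \<ge>
    (if even m then 2 / 3 * (real q ^ 3 + real q ^ 2 - 2 * real q) - 1
     else 2 / 3 * (real q ^ 3 + real q ^ 2 + real q) - 1)"
proof -
  interpret conic_unital m q \<theta>
    using assms by unfold_locales
  let ?d = "real (vec.dim (binary_code q (\<lambda>x. x ^ 2) (unital_U q \<theta>)))"
  have "real q \<ge> 3" using q_ge by simp
  \<comment> \<open>This product is nine times the gap between the two bounds compared next.\<close>
  then have "0 \<le> real q * ((real q - 1) * (real q - 3))" by simp
  then have "2 / 3 * (real q ^ 3 + real q ^ 2 + real q) - 1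
      \<le> (7 * real q ^ 3 + 2 * real q ^ 2 + 9 * real q - 9) / 9"
    by (simp add: algebra_simps power3_eq_cube power2_eq_square)
  also have "\<dots> \<le> ?d" using dim_binary_code_ge by simp
  finally have bound: "2 / 3 * (real q ^ 3 + real q ^ 2 + real q) - 1 \<le> ?d" .
  show ?thesis
  proof (cases "even m")
    case True
    \<comment> \<open>The target for even m is lower by 2q, so the bound already obtained covers
      it.\<close>
    have "2 / 3 * (real q ^ 3 + real q ^ 2 - 2 * real q)
        \<le> 2 / 3 * (real q ^ 3 + real q ^ 2 + real q)"
      by (intro mult_left_mono) simp_all
    then show ?thesis unfolding if_P[OF True] using bound by linarith
  qed (use bound in simp)
qed

end
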